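(* Let $G$ be a finite group and let $S$ be a $2$-separable generating set of $G$ with $1\in S$ and $|S|\ge 3$. Assume that $|G|\ge 2\alpha_2(S)+\kappa_2(S)$ and $\kappa_2(S)=\kappa_1(S)=|S|-1$, and that no $2$-atom of $S$ or of $S^{-1}$ is a subgroup or has cardinality $2$. If $S$ does not have $2$-fragments that are subgroups of $G$, and if $A=H\cup Ha$ is a $2$-atom of $S$ which is the union of two right cosets of a subgroup $H$ of $G$ ($a\in G$), then $HS$ is the complement in $G$ of the union of exactly two right cosets $Hx$ modulo $H$.
   Context: Let $G$ be a finite group and $S$ a generating subset of $G$ containing $1$. For $X\subseteq G$ put $\partial X=XS\setminus X$ and $X^*=G\setminus (X\cup\partial X)=G\setminus XS$. For $k\ge 1$, $S$ is $k$-separable if there is $X\subseteq G$ with $|X|\ge k$ and $|X^*|\ge k$. If $S$ is $k$-separable, $\kappa_k(S)=\min\{|\partial X| : |X|\ge k,\ |X^*|\ge k\}$; a set $X$ with $|X|\ge k$, $|X^*|\ge k$ achieving this minimum is a $k$-fragment of $S$; a $k$-fragment of minimum cardinality is a $k$-atom of $S$; $\alpha_k(S)$ is the cardinality of a $k$-atom of $S$. The same notions for $S^{-1}=\{s^{-1}:s\in S\}$ are obtained by replacing $S$ by $S^{-1}$ throughout. *)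

theory Defs
  imports "HOL-Algebra.Coset" "HOL-Algebra.Generated_Groups"
begin

definition boundary :: "('a, 'b) monoid_scheme \<Rightarrow> 'a set \<Rightarrow> 'a set \<Rightarrow> 'a set" where
  "boundary G S X = (X <#>\<^bsub>G\<^esub> S) - X"

definition exterior :: "('a, 'b) monoid_scheme \<Rightarrow> 'a set \<Rightarrow> 'a set \<Rightarrow> 'a set" where
  "exterior G S X = carrier G - (X \<union> boundary G S X)"

definition admissible :: "('a, 'b) monoid_scheme \<Rightarrow> nat \<Rightarrow> 'a set \<Rightarrow> 'a set \<Rightarrow> bool" where
  "admissible G k S X \<longleftrightarrow> X \<subseteq> carrier G \<and> k \<le> card X \<and> k \<le> card (exterior G S X)"

definition separable :: "('a, 'b) monoid_scheme \<Rightarrow> nat \<Rightarrow> 'a set \<Rightarrow> bool" where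
  "separable G k S \<longleftrightarrow> (\<exists>X. admissible G k S X)"

(* The minima in connectivity and atom_card are only meaningful when G is finite
   and S is k-separable in G; otherwise their values are unspecified. *)

definition connectivity :: "('a, 'b) monoid_scheme \<Rightarrow> nat \<Rightarrow> 'a set \<Rightarrow> nat" where
  "connectivity G k S = Min {card (boundary G S X) | X. admissible G k S X}"

definition fragment :: "('a, 'b) monoid_scheme \<Rightarrow> nat \<Rightarrow> 'a set \<Rightarrow> 'a set \<Rightarrow> bool" where
  "fragment G k S X \<longleftrightarrow>
     admissible G k S X \<and> card (boundary G S X) = connectivity G k S"

definition atom_card :: "('a, 'b) monoid_scheme \<Rightarrow> nat \<Rightarrow> 'a set \<Rightarrow> nat" where
  "atom_card G k S = Min {card X | X. fragment G k S X}"

definition atom :: "('a, 'b) monoid_scheme \<Rightarrow> nat \<Rightarrow> 'a set \<Rightarrow> 'a set \<Rightarrow> bool" where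
  "atom G k S X \<longleftrightarrow> fragment G k S X \<and> card X = atom_card G k S"

end

theory Submission
  imports Defs
begin

text \<open>
  Write \<open>h = |H|\<close>, \<open>\<kappa> = |S| - 1\<close> for the common value of the two connectivities, and let
  \<open>X = G - AS\<close>. Since \<open>A\<close> is neither a subgroup nor a pair, \<open>A\<close> has \<open>2h\<close> elements and \<open>h \<ge> 2\<close>.
  As \<open>A\<close> is a fragment, \<open>|AS| = 2h + \<kappa>\<close>, whereas \<open>|HS| > h + \<kappa>\<close> because the subgroup \<open>H\<close> is
  admissible but not a fragment. Both \<open>HS \<subseteq> AS\<close> are unions of right cosets of \<open>H\<close>, so \<open>HS = AS\<close>.
  Hence \<open>X\<close> is the complement of \<open>HS\<close>, and the lower bound on \<open>|G|\<close> gives \<open>|X| \<ge> 2h\<close>; it remains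
  to show \<open>|X| \<le> 2h\<close>.

  Fix \<open>x \<in> X\<close> and call \<^emph>\<open>lines\<close> the left translates \<open>gA\<close> with \<open>x \<notin> gAS\<close>. They lie in
  \<open>N = {g. x \<notin> gS}\<close>, a set with \<open>|G| - |S| = |X| + 2h - 1\<close> elements. Since \<open>A\<close> is not a subgroup,
  the left stabilizer of \<open>A\<close> is \<open>H\<close>, so the number \<open>m\<close> of lines satisfies \<open>mh \<ge> |X|\<close>.
  Every nonempty \<open>F \<subseteq> N\<close> satisfies \<open>|FS| \<ge> |F| + \<kappa>\<close>, because \<open>x\<close> is exterior to \<open>F\<close>. By
  submodularity of \<open>F \<mapsto> |FS|\<close>, the sets \<open>F \<subseteq> N\<close> with \<open>|FS| = |F| + \<kappa>\<close> are closed under union and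
  intersection of pairs with a common point, and no such set with at least two elements is a
  proper subset of a line, because \<open>A\<close> is an atom. This forces the lines to overlap as little as the edges
  of a forest do (lemma \<open>card_Union_lines_ge\<close>): their union has at least \<open>m(2h - 1) + 1\<close>
  elements. Comparing with \<open>|N|\<close> and using \<open>|X| \<le> mh\<close> yields \<open>m(h - 1) \<le> 2(h - 1)\<close>, so \<open>m \<le> 2\<close>
  and \<open>|X| \<le> 2h\<close>.
\<close>

section \<open>A forest bound for submodular functions\<close>

text \<open>
  The sets \<open>F\<close> with \<open>p F = |F| + k\<close>, where \<open>|F| + k\<close> is the least value allowed, are called
  tight in the comments below. The lines are tight sets of \<open>n\<close> elements which contain no
  smaller tight set of two or more elements.
\<close>

locale tight_lines =
  fixes N :: "'a set" and p :: "'a set \<Rightarrow> nat" and k n :: nat and lines :: "'a set set"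
  assumes finite_N: "finite N"
    and submodular: "\<And>E F. E \<subseteq> N \<Longrightarrow> F \<subseteq> N \<Longrightarrow> p (E \<union> F) + p (E \<inter> F) \<le> p E + p F"
    and lower_bound: "\<And>F. F \<subseteq> N \<Longrightarrow> F \<noteq> {} \<Longrightarrow> card F + k \<le> p F"
    and line_subset: "\<And>L. L \<in> lines \<Longrightarrow> L \<subseteq> N"
    and card_line: "\<And>L. L \<in> lines \<Longrightarrow> card L = n"
    and line_tight: "\<And>L. L \<in> lines \<Longrightarrow> p L = n + k"
    and line_minimal: "\<And>L F. L \<in> lines \<Longrightarrow> F \<subseteq> L \<Longrightarrow> 2 \<le> card F \<Longrightarrow> p F = card F + k \<Longrightarrow> n \<le> card F"
    and three_le: "3 \<le> n"
begin

lemma tight_union_inter: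
  assumes "E \<subseteq> N" "F \<subseteq> N" "E \<inter> F \<noteq> {}" "p E = card E + k" "p F = card F + k"
  shows "p (E \<union> F) = card (E \<union> F) + k" "p (E \<inter> F) = card (E \<inter> F) + k"
proof -
  have fin: "finite E" "finite F"
    using assms finite_N finite_subset by auto
  have "card (E \<union> F) + card (E \<inter> F) = card E + card F"
    using card_Un_Int[OF fin] by simp
  moreover have "card (E \<union> F) + k \<le> p (E \<union> F)" "card (E \<inter> F) + k \<le> p (E \<inter> F)"
    using assms by (auto intro!: lower_bound)
  moreover have "p (E \<union> F) + p (E \<inter> F) \<le> p E + p F"
    using assms by (intro submodular)
  ultimately show "p (E \<union> F) = card (E \<union> F) + k" "p (E \<inter> F) = card (E \<inter> F) + k"
    using assms(4,5) by linarith+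
qed

lemma card_inter_tight:
  assumes "L \<in> lines" "F \<subseteq> N" "p F = card F + k"
  shows "card (F \<inter> L) \<le> 1 \<or> L \<subseteq> F"
proof (rule disjCI)
  assume nsub: "\<not> L \<subseteq> F"
  have fL: "finite L"
    using assms(1) finite_N finite_subset line_subset by blast
  have lt: "card (F \<inter> L) < n"
    using nsub fL card_line[OF assms(1)] by (metis inf.absorb_iff2 inf_le2 psubsetI psubset_card_mono)
  show "card (F \<inter> L) \<le> 1"
  proof (rule ccontr)
    assume two: "\<not> card (F \<inter> L) \<le> 1"
    then have "F \<inter> L \<noteq> {}" by auto
    then have "p (F \<inter> L) = card (F \<inter> L) + k"
      using assms line_subset card_line line_tight by (intro tight_union_inter(2)) auto
    then have "n \<le> card (F \<inter> L)"
      using assms(1) two by (intro line_minimal[of L]) auto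
    then show False using lt by simp
  qed
qed

lemma card_inter_lines:
  assumes "L \<in> lines" "L' \<in> lines" "L \<noteq> L'"
  shows "card (L \<inter> L') \<le> 1"
proof -
  have "\<not> L' \<subseteq> L"
    using assms card_line finite_N finite_subset line_subset by (metis card_subset_eq)
  then show ?thesis
    using card_inter_tight[of L' L] assms line_subset card_line line_tight by simp
qed

text \<open>
  A cluster is a connected family of lines, grown one line at a time inside the family \<open>\<M>\<close>.
  The last condition is what excludes cycles: every line of \<open>\<M>\<close> outside the cluster
  meets its union in at most one point.
\<close>

definition cluster :: "'a set set \<Rightarrow> 'a set set \<Rightarrow> bool" where
  "cluster \<M> \<C> \<longleftrightarrow> \<C> \<subseteq> \<M> \<and> \<C> \<noteq> {} \<and> p (\<Union>\<C>) = card (\<Union>\<C>) + k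
     \<and> card (\<Union>\<C>) = card \<C> * (n - 1) + 1 \<and> (\<forall>L\<in>\<M> - \<C>. card (\<Union>\<C> \<inter> L) \<le> 1)"

lemma cluster_single:
  assumes "\<M> \<subseteq> lines" "L \<in> \<M>"
  shows "cluster \<M> {L}"
proof -
  have "\<forall>L'\<in>\<M> - {L}. card (L \<inter> L') \<le> 1"
    using assms card_inter_lines by blast
  then show ?thesis
    using assms card_line[of L] line_tight[of L] three_le unfolding cluster_def by auto
qed

lemma cluster_insert:
  assumes \<M>: "\<M> \<subseteq> lines" and \<C>: "cluster \<M> \<C>" and fin: "finite \<C>"
    and L: "L \<in> \<M> - \<C>" "\<Union>\<C> \<inter> L \<noteq> {}"
  shows "cluster \<M> (insert L \<C>)"
proof -
  let ?F = "\<Union>\<C>"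
  have FN: "?F \<subseteq> N" and LN: "L \<subseteq> N" and Ll: "L \<in> lines"
    using \<M> \<C> L line_subset unfolding cluster_def by blast+
  have finF: "finite ?F" and finL: "finite L"
    using FN LN finite_N finite_subset by blast+
  have Ft: "p ?F = card ?F + k" and cF: "card ?F = card \<C> * (n - 1) + 1"
    using \<C> unfolding cluster_def by auto
  have tight: "p (?F \<union> L) = card (?F \<union> L) + k"
    using FN LN L(2) Ft line_tight[OF Ll] card_line[OF Ll] by (intro tight_union_inter(1)) auto
  have "card (?F \<inter> L) \<le> 1"
    using \<C> L(1) unfolding cluster_def by blast
  moreover have "card (?F \<inter> L) \<noteq> 0"
    using L(2) finL by (subst card_0_eq) auto
  ultimately have "card (?F \<inter> L) = 1" by simp
  then have "card (?F \<union> L) + 1 = card ?F + n"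
    using card_Un_Int[OF finF finL] card_line[OF Ll] by simp
  then have card: "card (?F \<union> L) = card (insert L \<C>) * (n - 1) + 1"
    using cF L(1) fin three_le by simp
  have small: "card ((?F \<union> L) \<inter> L') \<le> 1" if L': "L' \<in> \<M> - insert L \<C>" for L'
  proof -
    have l': "L' \<in> lines" using L' \<M> by blast
    have "card (?F \<inter> L') \<le> 1"
      using \<C> L' unfolding cluster_def by blast
    moreover have "card (L \<inter> L') \<le> 1"
      using card_inter_lines[OF Ll l'] L' by blast
    moreover have "card ((?F \<union> L) \<inter> L') \<le> card (?F \<inter> L') + card (L \<inter> L')"
      unfolding Int_Un_distrib2 by (rule card_Un_le)
    \<comment> \<open>Two points in common are fewer than \<open>n\<close>, so the new union cannot contain the whole line.\<close>
    ultimately have "card ((?F \<union> L) \<inter> L') < n"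
      using three_le by linarith
    then have "\<not> L' \<subseteq> ?F \<union> L"
      using card_line[OF l'] by (metis inf.absorb2 less_irrefl)
    then show ?thesis
      using card_inter_tight[OF l' _ tight] FN LN by blast
  qed
  have "\<Union>(insert L \<C>) = ?F \<union> L" by blast
  then show ?thesis
    using \<C> L(1) tight card small unfolding cluster_def by auto
qed

lemma card_Union_lines_ge:
  assumes "\<M> \<subseteq> lines" "\<M> \<noteq> {}"
  shows "card \<M> * (n - 1) + 1 \<le> card (\<Union>\<M>)"
proof -
  have "finite \<M>"
    using assms(1) line_subset finite_N by (meson Pow_iff finite_Pow_iff finite_subset subsetI subset_iff)
  then show ?thesis
    using assms
  proof (induction \<M> rule: finite_psubset_induct)
    case (psubset \<M>)
    obtain L0 where "L0 \<in> \<M>" using psubset.prems by blast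
    then have "{L0} \<in> {\<C>. cluster \<M> \<C>}"
      using cluster_single psubset.prems by blast
    moreover have "finite {\<C>. cluster \<M> \<C>}"
      by (rule finite_subset[of _ "Pow \<M>"]) (auto simp: cluster_def psubset.hyps)
    ultimately obtain \<C> where \<C>: "cluster \<M> \<C>"
      and max: "\<And>\<D>. cluster \<M> \<D> \<Longrightarrow> \<C> \<subseteq> \<D> \<Longrightarrow> \<D> = \<C>"
      using finite_has_maximal2 by (metis (mono_tags, lifting) mem_Collect_eq)
    have sub: "\<C> \<subseteq> \<M>" "\<C> \<noteq> {}" and card: "card (\<Union>\<C>) = card \<C> * (n - 1) + 1"
      using \<C> unfolding cluster_def by auto
    have fin\<C>: "finite \<C>"
      using sub psubset.hyps finite_subset by blast
    have disj: "\<Union>\<C> \<inter> L = {}" if "L \<in> \<M> - \<C>" for L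
      using cluster_insert[OF psubset.prems(1) \<C> fin\<C> that] max[of "insert L \<C>"] that by blast
    let ?R = "\<M> - \<C>"
    have finU: "finite (\<Union>\<M>)"
      using psubset.prems line_subset finite_N by (meson Sup_least finite_subset subset_iff)
    have rest: "card ?R * (n - 1) \<le> card (\<Union>?R)"
    proof (cases "?R = {}")
      case False
      then have "card ?R * (n - 1) + 1 \<le> card (\<Union>?R)"
        using sub psubset.prems by (intro psubset.IH) auto
      then show ?thesis by simp
    next
      case True
      then show ?thesis by (metis card.empty le0 mult_0)
    qed
    have "\<Union>\<M> = \<Union>\<C> \<union> \<Union>?R" using sub by blast
    moreover have "\<Union>\<C> \<inter> \<Union>?R = {}" using disj by blast
    ultimately have "card (\<Union>\<M>) = card (\<Union>\<C>) + card (\<Union>?R)"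
      using finU by (metis card_Un_disjoint finite_Un)
    moreover have "card \<M> = card \<C> + card ?R"
      using sub fin\<C> psubset.hyps by (simp add: card_Diff_subset card_mono)
    ultimately show ?case
      using card rest by (simp add: algebra_simps)
  qed
qed

end

section \<open>Product sets and unions of cosets\<close>

context group
begin

lemma card_l_coset:
  assumes "A \<subseteq> carrier G" "g \<in> carrier G"
  shows "card (g <# A) = card A"
proof -
  have "g <# A = (\<lambda>y. g \<otimes> y) ` A"
    unfolding l_coset_def by blast
  moreover have "inj_on (\<lambda>y. g \<otimes> y) A"
    using assms by (auto simp: inj_on_def subset_eq)
  ultimately show ?thesis by (simp add: card_image)
qed

lemma l_coset_set_mult:
  assumes "A \<subseteq> carrier G" "S \<subseteq> carrier G" "g \<in> carrier G"
  shows "(g <# A) <#> S = g <# (A <#> S)"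
  using assms by (simp add: l_coset_eq_set_mult set_mult_assoc)

lemma mem_l_coset_iff:
  assumes "A \<subseteq> carrier G" "g \<in> carrier G" "y \<in> carrier G"
  shows "y \<in> g <# A \<longleftrightarrow> inv g \<otimes> y \<in> A"
proof
  assume "y \<in> g <# A"
  then show "inv g \<otimes> y \<in> A"
    using assms by (auto simp: l_coset_def subset_eq m_assoc[symmetric])
next
  assume "inv g \<otimes> y \<in> A"
  moreover have "g \<otimes> (inv g \<otimes> y) = y"
    using assms by (simp add: m_assoc[symmetric])
  ultimately show "y \<in> g <# A"
    unfolding l_coset_def by force
qed

lemma subset_set_mult_right:
  assumes "A \<subseteq> carrier G" "\<one> \<in> S"
  shows "A \<subseteq> A <#> S"
proof
  fix y assume "y \<in> A"
  then have "y = y \<otimes> \<one>" "y \<in> A" using assms by auto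
  then show "y \<in> A <#> S" using assms(2) unfolding set_mult_def by blast
qed

lemma card_set_mult_submodular:
  assumes "finite (carrier G)" "S \<subseteq> carrier G" "E \<subseteq> carrier G" "F \<subseteq> carrier G"
  shows "card ((E \<union> F) <#> S) + card ((E \<inter> F) <#> S) \<le> card (E <#> S) + card (F <#> S)"
proof -
  have fin: "finite (E <#> S)" "finite (F <#> S)"
    using assms setmult_subset_G finite_subset by meson+
  have "(E \<union> F) <#> S = (E <#> S) \<union> (F <#> S)"
    unfolding set_mult_def by blast
  moreover have "card ((E \<inter> F) <#> S) \<le> card ((E <#> S) \<inter> (F <#> S))"
    using fin by (intro card_mono) (auto simp: set_mult_def)
  ultimately show ?thesis
    using card_Un_Int[OF fin] by simp
qed

lemma subgroup_of_finite_closed: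
  assumes "A \<subseteq> carrier G" "finite A" "\<one> \<in> A"
    and closed: "\<And>u v. u \<in> A \<Longrightarrow> v \<in> A \<Longrightarrow> u \<otimes> v \<in> A"
  shows "subgroup A G"
proof (rule subgroupI)
  fix u assume u: "u \<in> A"
  have "inj_on (\<lambda>v. u \<otimes> v) A"
    using assms(1) u by (auto simp: inj_on_def subset_eq)
  then have "(\<lambda>v. u \<otimes> v) ` A = A"
    using assms(2) closed u by (intro endo_inj_surj) auto
  then obtain v where v: "v \<in> A" "u \<otimes> v = \<one>" using assms(3) by force
  then have "inv u = v"
    using u assms(1) by (metis inv_comm inv_equality subset_iff)
  then show "inv u \<in> A" using v by simp
qed (use assms in auto)

lemma set_mult_l_subgroup_absorb:
  assumes "subgroup H G" "Y \<subseteq> carrier G"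
  shows "H <#> (H <#> Y) = H <#> Y"
  using assms by (metis set_mult_assoc subgroup.subset subgroup_mult_id)

lemma card_r_coset:
  assumes "finite (carrier G)" "subgroup H G" "y \<in> carrier G"
  shows "card (H #> y) = card H"
  using assms by (metis card_rcosets_equal rcosetsI subgroup.subset)

lemma r_coset_disjoint:
  assumes "subgroup H G" "x \<in> carrier G" "y \<in> carrier G" "y \<notin> H #> x"
  shows "(H #> x) \<inter> (H #> y) = {}"
proof -
  have "H #> x \<noteq> H #> y"
    using assms rcos_self by metis
  then show ?thesis
    using rcos_disjoint[OF assms(1)] assms rcosetsI[OF subgroup.subset[OF assms(1)]]
    unfolding pairwise_def disjnt_def by blast
qed

lemma dvd_card_union_r_cosets:
  assumes "finite (carrier G)" "subgroup H G" "Y \<subseteq> carrier G" "H <#> Y = Y"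
  shows "card H dvd card Y"
proof -
  let ?C = "(\<lambda>y. H #> y) ` Y"
  have U: "\<Union>?C = Y"
    using assms(4) unfolding set_mult_def r_coset_def by blast
  have "card H dvd card (\<Union>?C)"
  proof (rule dvd_partition)
    show "finite (\<Union>?C)" using U assms finite_subset by metis
    show "\<forall>c\<in>?C. card H dvd card c"
      using assms card_r_coset by auto
    have "?C \<subseteq> rcosets H"
      using assms by (auto intro!: rcosetsI subgroup.subset)
    then show "\<forall>c1\<in>?C. \<forall>c2\<in>?C. c1 \<noteq> c2 \<longrightarrow> c1 \<inter> c2 = {}"
      using rcos_disjoint[OF assms(2)] unfolding pairwise_def disjnt_def by blast
  qed
  then show ?thesis using U by simp
qed

lemma two_r_cosets:
  assumes "finite (carrier G)" "subgroup H G" "Y \<subseteq> carrier G" "H <#> Y = Y"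
    and "card Y = 2 * card H"
  shows "\<exists>R1\<in>rcosets H. \<exists>R2\<in>rcosets H. R1 \<noteq> R2 \<and> Y = R1 \<union> R2"
proof -
  have finY: "finite Y" and finH: "finite H"
    using assms finite_subset subgroup.subset by metis+
  have hpos: "card H > 0"
    using finH subgroup.one_closed[OF assms(2)] by (auto simp: card_gt_0_iff)
  have sub: "H #> y \<subseteq> Y" if "y \<in> Y" for y
    using that assms(4) unfolding set_mult_def r_coset_def by blast
  obtain x where x: "x \<in> Y"
    using assms(5) hpos by fastforce
  have cx: "card (H #> x) = card H"
    using x assms card_r_coset by blast
  then have "Y \<noteq> H #> x" using assms(5) hpos by auto
  then obtain y where y: "y \<in> Y" "y \<notin> H #> x"
    using sub[OF x] by blast
  have cy: "card (H #> y) = card H"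
    using y assms card_r_coset by blast
  have disj: "(H #> x) \<inter> (H #> y) = {}"
    using r_coset_disjoint x y assms by blast
  have "card ((H #> x) \<union> (H #> y)) = card Y"
    using card_Un_disjoint[OF _ _ disj] finite_subset[OF sub finY] x y cx cy assms(5) by simp
  then have "Y = (H #> x) \<union> (H #> y)"
    using card_subset_eq[OF finY] sub x y by (metis Un_least)
  moreover have "H #> x \<noteq> H #> y"
    using y assms rcos_self by blast
  moreover have "H #> x \<in> rcosets H" "H #> y \<in> rcosets H"
    using x y assms by (auto intro!: rcosetsI subgroup.subset)
  ultimately show ?thesis by blast
qed

text \<open>
  If \<open>u\<close> stabilizes \<open>H \<union> Ha\<close> and is not in \<open>H\<close>, then \<open>Ha = Hu\<close> and the set is closed under
  multiplication.
\<close>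

lemma stabilizer_two_cosets:
  assumes "finite (carrier G)" "subgroup H G" "a \<in> carrier G" "A = H \<union> (H #> a)"
    and "\<not> subgroup A G" and "u <# A = A" "u \<in> carrier G"
  shows "u \<in> H"
proof (rule ccontr)
  assume nH: "u \<notin> H"
  interpret subgroup H G by fact
  have AG: "A \<subseteq> carrier G"
    using assms(3,4) subset r_coset_subset_G by auto
  have oneA: "\<one> \<in> A" using assms(4) by simp
  have stab: "u \<otimes> v \<in> A" if "v \<in> A" for v
    using that assms(6) unfolding l_coset_def by blast
  have "u \<in> A" using stab[OF oneA] assms(7) by simp
  then have "H #> a = H #> u"
    using nH assms(2,3,4) repr_independence by blast
  then have Au: "A = H \<union> (H #> u)" using assms(4) by simp
  have HA: "g \<otimes> v \<in> A" if g: "g \<in> H" and v: "v \<in> A" for g v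
    using v unfolding assms(4)
  proof
    assume "v \<in> H #> a"
    then obtain g' where "g' \<in> H" "v = g' \<otimes> a" unfolding r_coset_def by blast
    then have "g \<otimes> v = (g \<otimes> g') \<otimes> a" "g \<otimes> g' \<in> H"
      using g assms(3) by (auto simp: m_assoc)
    then show "g \<otimes> v \<in> H \<union> (H #> a)" unfolding r_coset_def by blast
  qed (use g in simp)
  have "subgroup A G"
  proof (rule subgroup_of_finite_closed[OF AG _ oneA])
    show "finite A" using AG assms(1) finite_subset by blast
    fix w v assume w: "w \<in> A" and v: "v \<in> A"
    show "w \<otimes> v \<in> A"
      using w unfolding Au
    proof
      assume "w \<in> H #> u"
      then obtain g where g: "g \<in> H" "w = g \<otimes> u" unfolding r_coset_def by blast
      then have "w \<otimes> v = g \<otimes> (u \<otimes> v)"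
        using AG v assms(7) by (auto simp: m_assoc)
      then show "w \<otimes> v \<in> H \<union> (H #> u)"
        using HA[OF g(1) stab[OF v]] Au by simp
    qed (use HA v Au in blast)
  qed
  then show False using assms(5) by simp
qed

end

section \<open>Connectivity and fragments\<close>

context group
begin

lemma exterior_eq:
  assumes "X \<subseteq> carrier G" "\<one> \<in> S"
  shows "exterior G S X = carrier G - (X <#> S)"
  using subset_set_mult_right[OF assms] unfolding exterior_def boundary_def by blast

lemma card_boundary:
  assumes "finite (carrier G)" "S \<subseteq> carrier G" "X \<subseteq> carrier G" "\<one> \<in> S"
  shows "card (X <#> S) = card X + card (boundary G S X)"
proof -
  have sub: "X \<subseteq> X <#> S" using subset_set_mult_right assms by blast
  have fin: "finite (X <#> S)" using assms setmult_subset_G finite_subset by metis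
  have "finite X" using sub fin finite_subset by blast
  then show ?thesis
    unfolding boundary_def using card_mono[OF fin sub] card_Diff_subset[OF _ sub] by simp
qed

lemma connectivity_le:
  assumes "finite (carrier G)" "admissible G k S X"
  shows "connectivity G k S \<le> card (boundary G S X)"
proof -
  have "{card (boundary G S X) |X. admissible G k S X} \<subseteq> (\<lambda>X. card (boundary G S X)) ` Pow (carrier G)"
    unfolding admissible_def by blast
  then have "finite {card (boundary G S X) |X. admissible G k S X}"
    using assms(1) finite_subset by blast
  then show ?thesis
    unfolding connectivity_def using assms(2) by (intro Min_le) auto
qed

lemma atom_card_le:
  assumes "finite (carrier G)" "fragment G k S X"
  shows "atom_card G k S \<le> card X"
proof -
  have "{card X |X. fragment G k S X} \<subseteq> card ` Pow (carrier G)"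
    unfolding fragment_def admissible_def by blast
  then have "finite {card X |X. fragment G k S X}"
    using assms(1) finite_subset by blast
  then show ?thesis
    unfolding atom_card_def using assms(2) by (intro Min_le) auto
qed

text \<open>
  Here \<open>H\<close> need only be a subgroup of order \<open>|A|/2\<close> that contains the left stabilizer of \<open>A\<close>.
  The translates \<open>gA\<close> whose product set \<open>gAS\<close> misses a given point \<open>x\<close> form a system of lines,
  with \<open>p F = |FS|\<close>; the lower bound on \<open>p\<close> is the definition of the first connectivity, and
  the minimality of lines is that of the cardinality of \<open>A\<close> among fragments.
\<close>

lemma card_exterior_atom_le:
  assumes fin: "finite (carrier G)" and SG: "S \<subseteq> carrier G" and one: "\<one> \<in> S"
    and atom: "atom G 2 S A" and kappa: "connectivity G 2 S = connectivity G 1 S"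
    and kappa1: "connectivity G 1 S = card S - 1"
    and H: "subgroup H G" and stab: "\<And>u. u \<in> carrier G \<Longrightarrow> u <# A = A \<Longrightarrow> u \<in> H"
    and cA: "card A = 2 * card H" and h2: "2 \<le> card H"
  shows "card (exterior G S A) \<le> 2 * card H"
proof -
  define k where "k = card S - 1"
  define X where "X = carrier G - (A <#> S)"
  have frag: "fragment G 2 S A" and min: "atom_card G 2 S = 2 * card H"
    using atom cA unfolding atom_def by auto
  have AG: "A \<subseteq> carrier G"
    using frag unfolding fragment_def admissible_def by blast
  have extA: "exterior G S A = X"
    using exterior_eq[OF AG one] X_def by simp
  have X2: "2 \<le> card X"
    using frag extA unfolding fragment_def admissible_def by simp
  have XG: "X \<subseteq> carrier G" and finX: "finite X"
    using fin X_def by auto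
  have ASG: "A <#> S \<subseteq> carrier G" using setmult_subset_G AG SG .
  have cAS: "card (A <#> S) = 2 * card H + k"
    using card_boundary[OF fin SG AG one] frag kappa kappa1 cA
    unfolding fragment_def k_def by simp
  have Spos: "card S = k + 1"
    using one SG fin finite_subset unfolding k_def
    by (metis Suc_eq_plus1 Suc_pred' card_gt_0_iff empty_iff)
  obtain x where x: "x \<in> X" using X2 by fastforce
  have xG: "x \<in> carrier G" using x XG by blast
  define N where "N = {g \<in> carrier G. x \<notin> g <# S}"
  define lines where "lines = (\<lambda>y. (x \<otimes> inv y) <# A) ` X"
  have NG: "N \<subseteq> carrier G" unfolding N_def by blast
  have x_notin: "x \<notin> F <#> S" if "F \<subseteq> N" for F
    using that unfolding N_def set_mult_def l_coset_def by blast
  have line: "L \<subseteq> N \<and> L \<subseteq> carrier G \<and> card L = 2 * card H \<and> card (L <#> S) = 2 * card H + k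
      \<and> card (carrier G - (L <#> S)) \<ge> 2" if mem: "L \<in> lines" for L
  proof -
    obtain y where y: "y \<in> X" and L: "L = (x \<otimes> inv y) <# A"
      using mem unfolding lines_def by blast
    have yG: "y \<in> carrier G" using y XG by blast
    then have gG: "x \<otimes> inv y \<in> carrier G" using xG by simp
    have LG: "L \<subseteq> carrier G" using L AG gG by (simp add: l_coset_subset_G)
    have LS: "L <#> S = (x \<otimes> inv y) <# (A <#> S)"
      using L l_coset_set_mult AG SG gG by simp
    have "inv (x \<otimes> inv y) \<otimes> x = y"
      using xG yG by (simp add: inv_mult_group m_assoc)
    then have "x \<notin> L <#> S"
      using mem_l_coset_iff[OF ASG gG xG] y LS unfolding X_def by simp
    then have "L \<subseteq> N"
      using LG unfolding N_def set_mult_def l_coset_def by blast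
    moreover have "card (L <#> S) = card (A <#> S)"
      using LS card_l_coset[OF ASG gG] by simp
    moreover have "card (carrier G - (L <#> S)) = card X"
    proof -
      have "L <#> S \<subseteq> carrier G" using setmult_subset_G LG SG .
      then show ?thesis
        using \<open>card (L <#> S) = card (A <#> S)\<close> ASG fin finite_subset unfolding X_def
        by (simp add: card_Diff_subset finite_subset[OF _ fin])
    qed
    moreover have "card L = card A" using L card_l_coset[OF AG gG] by simp
    ultimately show ?thesis using LG X2 cAS cA by simp
  qed
  interpret tight_lines N "\<lambda>F. card (F <#> S)" k "2 * card H" lines
  proof
    show "finite N" using NG fin finite_subset by blast
    show "card ((E \<union> F) <#> S) + card ((E \<inter> F) <#> S) \<le> card (E <#> S) + card (F <#> S)"
      if "E \<subseteq> N" "F \<subseteq> N" for E F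
      using that NG by (intro card_set_mult_submodular[OF fin SG]) auto
    show "card F + k \<le> card (F <#> S)" if F: "F \<subseteq> N" "F \<noteq> {}" for F
    proof -
      have FG: "F \<subseteq> carrier G" using F NG by blast
      have "x \<in> exterior G S F"
        using exterior_eq[OF FG one] x_notin[OF F(1)] xG by blast
      then have "1 \<le> card (exterior G S F)"
        using fin unfolding exterior_def by (metis One_nat_def Suc_leI card_gt_0_iff empty_iff finite_Diff)
      moreover have "1 \<le> card F"
        using F FG fin finite_subset by (metis One_nat_def Suc_leI card_gt_0_iff)
      ultimately have "admissible G 1 S F"
        using FG unfolding admissible_def by blast
      then show ?thesis
        using connectivity_le[OF fin] kappa1 card_boundary[OF fin SG FG one] unfolding k_def by force
    qed
    show "L \<subseteq> N" "card L = 2 * card H" "card (L <#> S) = 2 * card H + k" if "L \<in> lines" for L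
      using line[OF that] by auto
    show "2 * card H \<le> card F" if L: "L \<in> lines" and F: "F \<subseteq> L" "2 \<le> card F"
      and tight: "card (F <#> S) = card F + k" for L F
    proof -
      have FG: "F \<subseteq> carrier G" using F line[OF L] by blast
      have "carrier G - (L <#> S) \<subseteq> exterior G S F"
        unfolding exterior_eq[OF FG one] using F(1) unfolding set_mult_def by blast
      then have "card (carrier G - (L <#> S)) \<le> card (exterior G S F)"
        using fin by (intro card_mono) (auto simp: exterior_def)
      then have "2 \<le> card (exterior G S F)"
        using line[OF L] by linarith
      then have "admissible G 2 S F"
        using FG F(2) unfolding admissible_def by blast
      then have "fragment G 2 S F"
        using tight card_boundary[OF fin SG FG one] kappa kappa1 unfolding fragment_def k_def by simp
      then show ?thesis using atom_card_le[OF fin] min by fastforce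
    qed
    show "3 \<le> 2 * card H" using h2 by simp
  qed
  have linesN: "lines \<noteq> {}" unfolding lines_def using x by blast
  have lower: "card lines * (2 * card H - 1) + 1 \<le> card N"
  proof -
    have "\<Union>lines \<subseteq> N" using line_subset by blast
    then have "card (\<Union>lines) \<le> card N" using finite_N card_mono by blast
    then show ?thesis using card_Union_lines_ge[OF subset_refl linesN] by linarith
  qed
  \<comment> \<open>The complement of \<open>N\<close> consists of the elements \<open>x s\<inverse>\<close> with \<open>s\<close> in \<open>S\<close>.\<close>
  have cN: "card N = card X + 2 * card H - 1"
  proof -
    let ?f = "\<lambda>s. x \<otimes> inv s"
    have "carrier G - N = ?f ` S"
    proof (intro equalityI subsetI)
      fix g assume "g \<in> carrier G - N"
      then obtain s where s: "s \<in> S" "x = g \<otimes> s" "g \<in> carrier G"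
        unfolding N_def l_coset_def by blast
      then have "g = x \<otimes> inv s" using SG by (auto simp: m_assoc subset_iff)
      then show "g \<in> ?f ` S" using s by blast
    next
      fix g assume "g \<in> ?f ` S"
      then obtain s where s: "s \<in> S" "g = x \<otimes> inv s" by blast
      then have "g \<otimes> s = x" "g \<in> carrier G" using SG xG by (auto simp: m_assoc subset_iff)
      then show "g \<in> carrier G - N" using s unfolding N_def l_coset_def by blast
    qed
    moreover have "inj_on ?f S"
      using SG xG by (simp add: inj_on_def subset_iff) (metis inv_inv)
    ultimately have "card (carrier G - N) = card S" by (simp add: card_image)
    moreover have "card (carrier G - N) = card (carrier G) - card N" "card N \<le> card (carrier G)"
      using NG fin finite_N by (auto simp: card_Diff_subset card_mono)
    moreover have "card X = card (carrier G) - card (A <#> S)" "card (A <#> S) \<le> card (carrier G)"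
      using ASG fin finite_subset[OF ASG fin] unfolding X_def
      by (auto simp: card_Diff_subset card_mono)
    ultimately show ?thesis using cAS Spos h2 by linarith
  qed
  \<comment> \<open>Elements of \<open>X\<close> giving the same line lie in the same right coset of \<open>H\<close>.\<close>
  have upper: "card X \<le> card lines * card H"
  proof -
    define fib where "fib L = {y \<in> X. (x \<otimes> inv y) <# A = L}" for L
    have fib: "card (fib L) \<le> card H" if mem: "L \<in> lines" for L
    proof -
      obtain z where z: "z \<in> X" "L = (x \<otimes> inv z) <# A"
        using mem unfolding lines_def by blast
      have zG: "z \<in> carrier G" using z XG by blast
      have "fib L \<subseteq> H #> z"
      proof
        fix y assume "y \<in> fib L"
        then have y: "y \<in> X" "(x \<otimes> inv y) <# A = (x \<otimes> inv z) <# A"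
          using z unfolding fib_def by auto
        have yG: "y \<in> carrier G" using y XG by blast
        have eq: "y \<otimes> inv x \<otimes> (x \<otimes> inv y) = \<one>" "y \<otimes> inv x \<otimes> (x \<otimes> inv z) = y \<otimes> inv z"
          using xG yG zG by (simp_all add: m_assoc inv_solve_left' flip: m_assoc[of "inv x" x])
        have "(y \<otimes> inv x) <# ((x \<otimes> inv y) <# A) = (y \<otimes> inv x) <# ((x \<otimes> inv z) <# A)"
          using y(2) by simp
        then have "(y \<otimes> inv z) <# A = \<one> <# A"
          using xG yG zG AG by (simp add: lcos_m_assoc eq)
        then have "y \<otimes> inv z \<in> H"
          using stab yG zG AG lcos_mult_one by simp
        then show "y \<in> H #> z"
          using subgroup.rcos_module_rev[OF H is_group zG yG] by blast
      qed
      moreover have "finite (H #> z)"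
        using r_coset_subset_G[OF subgroup.subset[OF H] zG] fin finite_subset by blast
      ultimately show ?thesis
        using card_mono card_r_coset[OF fin H zG] by metis
    qed
    have finl: "finite lines" unfolding lines_def using finX by simp
    have "X = (\<Union>L\<in>lines. fib L)"
      unfolding lines_def fib_def by blast
    then have "card X \<le> (\<Sum>L\<in>lines. card (fib L))"
      using card_UN_le[OF finl, of fib] by simp
    also have "\<dots> \<le> card lines * card H"
      using sum_bounded_above[of lines "\<lambda>L. card (fib L)" "card H"] fib by simp
    finally show ?thesis .
  qed
  have "card lines \<le> 2"
  proof (rule ccontr)
    assume "\<not> card lines \<le> 2"
    then obtain m where m: "card lines = m + 3"
      by (metis add.commute less_eqE not_less_eq_eq numeral_2_eq_2 numeral_3_eq_3)
    obtain h where h: "card H = h + 2"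
      using h2 by (metis add.commute less_eqE)
    have "2 * card H - 1 = 2 * h + 3" using h by simp
    then have "(m + 3) * (2 * h + 3) + 1 \<le> card N"
      using lower m by simp
    moreover have "card N = card X + 2 * h + 3" using cN h by simp
    moreover have "card X \<le> (m + 3) * (h + 2)" using upper m h by simp
    ultimately have "(m + 3) * (2 * h + 3) + 1 \<le> (m + 3) * (h + 2) + 2 * h + 3"
      by linarith
    then show False by (simp add: algebra_simps)
  qed
  then have "card lines * card H \<le> 2 * card H" by (rule mult_le_mono1)
  then show ?thesis using le_trans[OF upper] extA by simp
qed

end

section \<open>Atoms that are unions of two cosets\<close>

theorem theorem14:
  fixes G :: "('a, 'b) monoid_scheme" (structure)
    and S A H :: "'a set" and a :: 'a
  assumes "group G" and "finite (carrier G)"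
    and "S \<subseteq> carrier G" and "generate G S = carrier G"
    and "\<one> \<in> S" and "card S \<ge> 3"
    and "separable G 2 S"
    and "card (carrier G) \<ge> 2 * atom_card G 2 S + connectivity G 2 S"
    and "connectivity G 2 S = connectivity G 1 S"
    and "connectivity G 1 S = card S - 1"
    and "\<And>F. atom G 2 S F \<or> atom G 2 (set_inv S) F \<Longrightarrow> \<not> subgroup F G \<and> card F \<noteq> 2"
    and "\<And>F. fragment G 2 S F \<Longrightarrow> \<not> subgroup F G"
    and "subgroup H G" and "a \<in> carrier G"
    and "A = H \<union> (H #> a)" and "atom G 2 S A"
  shows "\<exists>R1 \<in> rcosets H. \<exists>R2 \<in> rcosets H. R1 \<noteq> R2 \<and> H <#> S = carrier G - (R1 \<union> R2)"
proof -
  interpret group G by fact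
  note fin = assms(2) and SG = assms(3) and one = assms(5) and kappa = assms(9) and kappa1 = assms(10)
    and H = assms(13) and aG = assms(14) and A = assms(15) and atom = assms(16)
  have HG: "H \<subseteq> carrier G" using H subgroup.subset by blast
  have finH: "finite H" using HG fin finite_subset by blast
  have frag: "fragment G 2 S A" and cardA: "card A = atom_card G 2 S"
    using atom unfolding atom_def by auto
  have nsub: "\<not> subgroup A G" and card2: "card A \<noteq> 2"
    using assms(11)[of A] atom by auto
  have AG: "A \<subseteq> carrier G" and extA: "2 \<le> card (exterior G S A)"
    using frag unfolding fragment_def admissible_def by auto
  have "a \<notin> H"
    using nsub A H coset_join2[OF aG H] by auto
  then have disj: "H \<inter> (H #> a) = {}"
    using r_coset_disjoint[OF H one_closed aG] coset_mult_one[OF HG] by simp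
  have "finite (H #> a)"
    using r_coset_subset_G[OF HG aG] fin finite_subset by blast
  then have cA: "card A = 2 * card H"
    using card_Un_disjoint[OF finH _ disj] card_r_coset[OF fin H aG] A by simp
  have h2: "2 \<le> card H"
  proof -
    have "card H \<noteq> 0" using finH subgroup.one_closed[OF H] by auto
    moreover have "card H \<noteq> 1" using card2 cA by auto
    ultimately show ?thesis by linarith
  qed
  have HA: "H <#> A = A"
  proof -
    have "H <#> A = (H <#> H) \<union> (H <#> (H #> a))"
      unfolding A set_mult_def by blast
    then show ?thesis
      using setmult_rcos_assoc[OF HG HG aG] subgroup_mult_id[OF H] A by simp
  qed
  have ASG: "A <#> S \<subseteq> carrier G" and HSG: "H <#> S \<subseteq> carrier G"
    using setmult_subset_G AG HG SG by auto
  have dAS: "card H dvd card (A <#> S)"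
    using set_mult_assoc[OF HG AG SG] HA by (intro dvd_card_union_r_cosets[OF fin H ASG]) simp
  have HHS: "H <#> (H <#> S) = H <#> S"
    using set_mult_l_subgroup_absorb[OF H SG] .
  have dHS: "card H dvd card (H <#> S)"
    using HHS by (intro dvd_card_union_r_cosets[OF fin H HSG])
  have sub: "H <#> S \<subseteq> A <#> S"
    using A by (intro mono_set_mult) auto
  have cAS: "card (A <#> S) = 2 * card H + (card S - 1)"
    using card_boundary[OF fin SG AG one] frag kappa kappa1 cA unfolding fragment_def by simp
  have "exterior G S A \<subseteq> exterior G S H"
    using sub exterior_eq AG HG one by auto
  then have "card (exterior G S A) \<le> card (exterior G S H)"
    using fin by (intro card_mono) (auto simp: exterior_def)
  then have admH: "admissible G 2 S H"
    using extA HG h2 unfolding admissible_def by simp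
  have "card (boundary G S H) \<noteq> connectivity G 2 S"
    using assms(12)[of H] H admH unfolding fragment_def by blast
  then have gt: "card (H <#> S) > card H + (card S - 1)"
    using connectivity_le[OF fin admH] card_boundary[OF fin SG HG one] kappa kappa1 by linarith
  have HS: "H <#> S = A <#> S"
  proof (rule card_subset_eq[OF finite_subset[OF ASG fin] sub], rule ccontr)
    assume "card (H <#> S) \<noteq> card (A <#> S)"
    then have "card (H <#> S) < card (A <#> S)"
      using card_mono[OF finite_subset[OF ASG fin] sub] by linarith
    moreover have "card (A <#> S) - card (H <#> S) < card H"
      using gt cAS calculation by linarith
    moreover have "card H dvd card (A <#> S) - card (H <#> S)"
      using dAS dHS by (rule dvd_diff_nat)
    ultimately show False by (meson dvd_imp_le not_le zero_less_diff)
  qed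
  define X where "X = carrier G - (H <#> S)"
  have extX: "exterior G S A = X"
    using exterior_eq[OF AG one] HS X_def by simp
  have "card X \<le> 2 * card H"
    using card_exterior_atom_le[OF fin SG one atom kappa kappa1 H _ cA h2]
      stabilizer_two_cosets[OF fin H aG A nsub] extX by simp
  moreover have "2 * card H \<le> card X"
  proof -
    have "card X = card (carrier G) - card (A <#> S)"
      unfolding X_def HS using finite_subset[OF ASG fin] ASG by (rule card_Diff_subset)
    then show ?thesis
      using assms(8) cardA cA cAS kappa kappa1 by linarith
  qed
  ultimately have cX: "card X = 2 * card H" by simp
  have "H <#> X = X"
  proof
    show "X \<subseteq> H <#> X"
    proof
      fix y assume "y \<in> X"
      then show "y \<in> H <#> X"
        using subgroup.one_closed[OF H] l_one[of y] unfolding X_def set_mult_def by force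
    qed
    show "H <#> X \<subseteq> X"
    proof
      fix y assume "y \<in> H <#> X"
      then obtain g z where g: "g \<in> H" "z \<in> X" "y = g \<otimes> z" unfolding set_mult_def by blast
      have G: "g \<in> carrier G" "z \<in> carrier G" using g HG X_def by auto
      have "y \<notin> H <#> S"
      proof
        assume "y \<in> H <#> S"
        then have "inv g \<otimes> y \<in> H <#> (H <#> S)"
          using subgroup.m_inv_closed[OF H g(1)] unfolding set_mult_def by blast
        moreover have "inv g \<otimes> y = z" using g G by (simp add: m_assoc[symmetric])
        ultimately show False using g HHS X_def by simp
      qed
      then show "y \<in> X" using g G X_def by simp
    qed
  qed
  then obtain R1 R2 where R: "R1 \<in> rcosets H" "R2 \<in> rcosets H" "R1 \<noteq> R2" "X = R1 \<union> R2"
    using two_r_cosets[OF fin H _ _ cX] X_def by blast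
  moreover have "H <#> S = carrier G - X"
    using HSG X_def by blast
  ultimately show ?thesis by blast
qed

end
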